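(* Let $X,Y$ be metric spaces and $E,F$ nontrivial normed spaces. Suppose that $A(X,E)=C(X,E)$ or $C_*(X,E)$ and $A(Y,F)=C(Y,F)$ or $C_*(Y,F)$, and let $T:A(X,E)\to A(Y,F)$ be a biseparating map. Let $\varphi:X\to Y$ be the homeomorphism associated with $T$ and $\psi=\varphi^{-1}$. Then there is a function $\Phi:Y\times E\to F$ such that $$Tf(y)=\Phi(y,f(\psi(y)))\quad\text{for all } f\in A(X,E)\text{ and all } y\in Y.$$
   Context: $C(X,E)$ is the space of continuous functions $X\to E$ and $C_*(X,E)$ its subspace of bounded functions. For a function $f$ let $C(f)=\{x: f(x)\neq 0\}$, and for functions $f,g,h$ in the same space write $f\perp_h g$ if $C(f-h)\cap C(g-h)=\emptyset$. A map $T$ (not assumed linear) between two function spaces is biseparating if it is a bijection and for all $f,g,h$ in its domain: $f\perp_h g\iff Tf\perp_{Th}Tg$. The homeomorphism associated with $T$ is the homeomorphism $\varphi:X\to Y$ (the paper proves that one exists) with the property that for any $f,g\in A(X,E)$ and any open set $U$ in $X$, $f=g$ on $U$ if and only if $Tf=Tg$ on $\varphi(U)$. *)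

theory Defs
  imports "HOL-Analysis.Analysis"
begin

(* The spaces C(X,E) and C_*(X,E) are sets of functions on whole types; the latter is
   the library's set bcontfun of bounded continuous functions. *)
definition contfun :: "('a::topological_space \<Rightarrow> 'b::topological_space) set" where
  "contfun = {f. continuous_on UNIV f}"

definition cozero :: "('a \<Rightarrow> 'b::zero) \<Rightarrow> 'a set" where
  "cozero f = {x. f x \<noteq> 0}"

definition perp_at :: "('a \<Rightarrow> 'b::group_add) \<Rightarrow> ('a \<Rightarrow> 'b) \<Rightarrow> ('a \<Rightarrow> 'b) \<Rightarrow> bool" where
  "perp_at h f g \<longleftrightarrow> cozero (\<lambda>x. f x - h x) \<inter> cozero (\<lambda>x. g x - h x) = {}"

definition biseparating ::
  "('a \<Rightarrow> 'c::group_add) set \<Rightarrow> ('b \<Rightarrow> 'd::group_add) set \<Rightarrow> (('a \<Rightarrow> 'c) \<Rightarrow> ('b \<Rightarrow> 'd)) \<Rightarrow> bool" where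
  "biseparating A B T \<longleftrightarrow>
     bij_betw T A B \<and>
     (\<forall>f\<in>A. \<forall>g\<in>A. \<forall>h\<in>A. perp_at h f g \<longleftrightarrow> perp_at (T h) (T f) (T g))"

definition associated_homeomorphism ::
  "('a::topological_space \<Rightarrow> 'c) set \<Rightarrow> (('a \<Rightarrow> 'c) \<Rightarrow> ('b::topological_space \<Rightarrow> 'd)) \<Rightarrow> ('a \<Rightarrow> 'b) \<Rightarrow> bool" where
  "associated_homeomorphism A T \<phi> \<longleftrightarrow>
     homeomorphism UNIV UNIV \<phi> (inv \<phi>) \<and>
     (\<forall>f\<in>A. \<forall>g\<in>A. \<forall>U. open U \<longrightarrow>
        ((\<forall>x\<in>U. f x = g x) \<longleftrightarrow> (\<forall>y\<in>\<phi> ` U. T f y = T g y)))"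

end

theory Submission
  imports Defs
begin

text \<open>
  Since constant functions belong to \<open>A\<close>, the only candidate is \<open>\<Phi> (y, e) = T (\<lambda>_. e) y\<close>, and the
  theorem says that \<open>T f (\<phi> x)\<close> depends on \<open>f x\<close> alone: if \<open>f x = g x\<close>, then \<open>T f\<close> and \<open>T g\<close>
  agree at \<open>\<phi> x\<close>. The defining property of \<open>\<phi>\<close> transports equality on open sets only. This
  suffices when \<open>x\<close> is isolated. At a limit point, \<open>f\<close> and \<open>g\<close> can be joined by a third function
  \<open>h \<in> A\<close> that equals \<open>f\<close> on an open set \<open>U\<close> and \<open>g\<close> on an open set \<open>V\<close>, where \<open>x\<close> lies in the
  closure of both. Such an \<open>h\<close> interpolates between \<open>f\<close> and \<open>g\<close> with a cutoff that oscillates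
  near \<open>x\<close> (\<open>oscillating_cutoff\<close>); it is continuous at \<open>x\<close> precisely because \<open>f x = g x\<close>. Now
  \<open>T h\<close> equals \<open>T f\<close> on \<open>\<phi> ` U\<close> and \<open>T g\<close> on \<open>\<phi> ` V\<close>, and by continuity both equalities
  persist at \<open>\<phi> x\<close>, whence \<open>T f (\<phi> x) = T h (\<phi> x) = T g (\<phi> x)\<close>.
\<close>

text \<open>
  A sequence of distinct points tending to \<open>a\<close> splits into its even and its odd terms. Together
  with \<open>a\<close>, each half is closed, and the two closed sets meet only in \<open>a\<close>. Away from \<open>a\<close> the
  ratio of the distances to the two halves is therefore a Urysohn function that separates them, and
  truncating it makes it constant on a neighbourhood of each half.
\<close>

lemma oscillating_cutoff:
  fixes a :: "'a::metric_space"
  assumes "a islimpt UNIV"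
  obtains \<theta> :: "'a \<Rightarrow> real" and U V
  where "open U" "open V" "a \<in> closure U" "a \<in> closure V"
    "\<And>x. x \<in> U \<Longrightarrow> \<theta> x = 0" "\<And>x. x \<in> V \<Longrightarrow> \<theta> x = 1"
    "\<And>x. 0 \<le> \<theta> x" "\<And>x. \<theta> x \<le> 1" "continuous_on (- {a}) \<theta>"
proof -
  obtain s where s: "\<And>n. s n \<noteq> a" and inj: "inj s" and lim: "s \<longlonglongrightarrow> a"
    using assms unfolding limpt_sequential_inj by auto
  define P where "P = insert a (range (\<lambda>n. s (2 * n)))"
  define Q where "Q = insert a (range (\<lambda>n. s (2 * n + 1)))"
  define p where "p x = infdist x P" for x
  define q where "q x = infdist x Q" for x
  have limP: "(\<lambda>n. s (2 * n)) \<longlonglongrightarrow> a"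
    using LIMSEQ_subseq_LIMSEQ[OF lim, of "\<lambda>n. 2 * n"] by (simp add: o_def strict_mono_def)
  have limQ: "(\<lambda>n. s (2 * n + 1)) \<longlonglongrightarrow> a"
    using LIMSEQ_subseq_LIMSEQ[OF lim, of "\<lambda>n. 2 * n + 1"] by (simp add: o_def strict_mono_def)
  have "closed P" "closed Q"
    unfolding P_def Q_def
    using sequence_unique_limpt[OF limP] sequence_unique_limpt[OF limQ]
    by (auto simp: closed_limpt islimpt_insert)
  then have p0: "p x = 0 \<longleftrightarrow> x \<in> P" and q0: "q x = 0 \<longleftrightarrow> x \<in> Q" for x
    unfolding p_def q_def using in_closed_iff_infdist_zero[of P x] in_closed_iff_infdist_zero[of Q x]
    by (auto simp: P_def Q_def)
  have nonneg: "0 \<le> p x" "0 \<le> q x" for x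
    by (auto simp: p_def q_def infdist_nonneg)
  have cont: "continuous_on S p" "continuous_on S q" for S
    unfolding p_def q_def by (intro continuous_intros)+
  have meet: "P \<inter> Q = {a}"
  proof -
    have "s (2 * m) \<noteq> s (2 * n + 1)" for m n
      using inj by (metis dvd_triv_left even_plus_one_iff injD)
    then show ?thesis
      using s by (auto simp: P_def Q_def)
  qed
  have pos: "0 < p x + q x" if "x \<noteq> a" for x
  proof -
    have "p x \<noteq> 0 \<or> q x \<noteq> 0"
      using meet that p0 q0 by blast
    then show ?thesis
      using nonneg[of x] by linarith
  qed
  \<comment> \<open>\<open>U\<close> and \<open>V\<close> are where the ratio \<open>p / (p + q)\<close> is below \<open>1/3\<close> and above \<open>2/3\<close>; stating this without
    division excludes \<open>a\<close>, where \<open>p = q = 0\<close>, and makes openness evident.\<close>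
  define U where "U = {x. 2 * p x < q x}"
  define V where "V = {x. 2 * q x < p x}"
  define \<theta> where "\<theta> x = max 0 (min 1 (3 * (p x / (p x + q x)) - 1))" for x
  have "open U" "open V"
    unfolding U_def V_def by (intro open_Collect_less continuous_intros cont)+
  moreover have "a \<in> closure U"
  proof -
    have "s (2 * n) \<in> U" for n
    proof -
      have "s (2 * n) \<in> P" "s (2 * n) \<notin> Q"
        using meet s[of "2 * n"] by (auto simp: P_def)
      then show ?thesis
        using p0[of "s (2 * n)"] q0[of "s (2 * n)"] nonneg[of "s (2 * n)"] by (auto simp: U_def)
    qed
    then show ?thesis
      unfolding closure_sequential using limP by (intro exI[of _ "\<lambda>n. s (2 * n)"]) auto
  qed
  moreover have "a \<in> closure V"
  proof -
    have "s (2 * n + 1) \<in> V" for n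
    proof -
      have "s (2 * n + 1) \<in> Q" "s (2 * n + 1) \<notin> P"
        using meet s[of "2 * n + 1"] by (auto simp: Q_def)
      then show ?thesis
        using p0[of "s (2 * n + 1)"] q0[of "s (2 * n + 1)"] nonneg[of "s (2 * n + 1)"]
        by (auto simp: V_def)
    qed
    then show ?thesis
      unfolding closure_sequential using limQ by (intro exI[of _ "\<lambda>n. s (2 * n + 1)"]) auto
  qed
  moreover have "\<theta> x = 0" if "x \<in> U" for x
  proof -
    have "p x / (p x + q x) \<le> 1 / 3"
      using that nonneg[of x] by (auto simp: U_def field_simps)
    then show ?thesis
      unfolding \<theta>_def by linarith
  qed
  moreover have "\<theta> x = 1" if "x \<in> V" for x
  proof -
    have "2 / 3 \<le> p x / (p x + q x)"
      using that nonneg[of x] by (auto simp: V_def field_simps)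
    then show ?thesis
      unfolding \<theta>_def by linarith
  qed
  moreover have "0 \<le> \<theta> x" "\<theta> x \<le> 1" for x
    by (auto simp: \<theta>_def)
  moreover have "continuous_on (- {a}) \<theta>"
    unfolding \<theta>_def using pos by (intro continuous_intros cont) force
  ultimately show thesis
    using that by blast
qed

text \<open>
  At \<open>a\<close>, where the cutoff may be discontinuous, it is multiplied by the vanishing difference
  \<open>g - f\<close>, and boundedness of the cutoff is enough.
\<close>

lemma continuous_interpolation:
  fixes f g :: "'a::metric_space \<Rightarrow> 'b::real_normed_vector" and \<theta> :: "'a \<Rightarrow> real"
  assumes f: "continuous_on UNIV f" and g: "continuous_on UNIV g" and eq: "f a = g a"
    and \<theta>: "continuous_on (- {a}) \<theta>" and bound: "\<And>x. \<bar>\<theta> x\<bar> \<le> 1"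
  shows "continuous_on UNIV (\<lambda>x. f x + \<theta> x *\<^sub>R (g x - f x))"
proof -
  have "isCont (\<lambda>x. f x + \<theta> x *\<^sub>R (g x - f x)) x" for x
  proof (cases "x = a")
    case True
    have fa: "(f \<longlongrightarrow> f a) (at a)" and ga: "(g \<longlongrightarrow> f a) (at a)"
      using f g eq by (metis UNIV_I continuous_on_def)+
    have "((\<lambda>x. g x - f x) \<longlongrightarrow> 0) (at a)"
      using tendsto_diff[OF ga fa] by simp
    then have "((\<lambda>x. \<theta> x *\<^sub>R (g x - f x)) \<longlongrightarrow> 0) (at a)"
    proof (rule Lim_null_comparison[rotated, OF tendsto_norm_zero])
      show "\<forall>\<^sub>F x in at a. norm (\<theta> x *\<^sub>R (g x - f x)) \<le> norm (g x - f x)"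
        using bound by (auto intro!: always_eventually mult_left_le_one_le)
    qed
    then have "((\<lambda>x. f x + \<theta> x *\<^sub>R (g x - f x)) \<longlongrightarrow> f a + 0) (at a)"
      by (intro tendsto_add fa)
    then show ?thesis
      using True eq by (simp add: isCont_def)
  next
    case False
    then have "isCont \<theta> x"
      using \<theta> by (simp add: continuous_on_eq_continuous_at open_Compl)
    moreover have "isCont f x" "isCont g x"
      using f g by (simp_all add: continuous_on_eq_continuous_at)
    ultimately show ?thesis
      by (intro continuous_intros)
  qed
  then show ?thesis
    by (simp add: continuous_at_imp_continuous_on)
qed

text \<open>
  As the cutoff takes values in \<open>[0, 1]\<close>, the interpolant stays on the segment between
  \<open>f x\<close> and \<open>g x\<close>, so it inherits boundedness from \<open>f\<close> and \<open>g\<close>.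
\<close>

lemma interpolation_in_function_space:
  fixes f g :: "'a::metric_space \<Rightarrow> 'b::real_normed_vector" and \<theta> :: "'a \<Rightarrow> real"
  assumes A: "A = contfun \<or> A = bcontfun" and f: "f \<in> A" and g: "g \<in> A" and eq: "f a = g a"
    and \<theta>: "continuous_on (- {a}) \<theta>" "\<And>x. 0 \<le> \<theta> x" "\<And>x. \<theta> x \<le> 1"
  shows "(\<lambda>x. f x + \<theta> x *\<^sub>R (g x - f x)) \<in> A"
proof -
  have "continuous_on UNIV f" "continuous_on UNIV g"
    using A f g by (auto simp: contfun_def bcontfun_def)
  then have cont: "continuous_on UNIV (\<lambda>x. f x + \<theta> x *\<^sub>R (g x - f x))"
    using eq \<theta> by (intro continuous_interpolation) auto
  show ?thesis
  proof (cases "A = contfun")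
    case True
    then show ?thesis
      using cont by (simp add: contfun_def)
  next
    case False
    then have Ab: "A = bcontfun"
      using A by blast
    then obtain K L where K: "\<And>x. norm (f x) \<le> K" and L: "\<And>x. norm (g x) \<le> L"
      using f g by (auto simp: bcontfun_def bounded_iff)
    have "norm (f x + \<theta> x *\<^sub>R (g x - f x)) \<le> K + (L + K)" for x
    proof -
      have "norm (\<theta> x *\<^sub>R (g x - f x)) \<le> norm (g x - f x)"
        using \<theta>(2,3)[of x] by (auto intro!: mult_left_le_one_le)
      also have "\<dots> \<le> L + K"
        using norm_triangle_ineq4[of "g x" "f x"] K[of x] L[of x] by linarith
      finally show ?thesis
        using K[of x] by (intro norm_triangle_le) linarith
    qed
    then have "bounded (range (\<lambda>x. f x + \<theta> x *\<^sub>R (g x - f x)))"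
      unfolding bounded_iff by blast
    then show ?thesis
      using cont Ab by (simp add: bcontfun_def)
  qed
qed

text \<open>
  As \<open>T f\<close>, \<open>T g\<close> and \<open>\<phi>\<close> are continuous, equality transported from \<open>U\<close> to \<open>\<phi> ` U\<close> extends to the closure.
\<close>

lemma associated_homeomorphism_eq_on_closure:
  fixes T :: "('a::topological_space \<Rightarrow> 'c) \<Rightarrow> ('b::topological_space \<Rightarrow> 'd::t2_space)"
  assumes assoc: "associated_homeomorphism A T \<phi>"
    and "f \<in> A" "g \<in> A" and cont: "continuous_on UNIV (T f)" "continuous_on UNIV (T g)"
    and "open U" and "\<And>x. x \<in> U \<Longrightarrow> f x = g x" and "a \<in> closure U"
  shows "T f (\<phi> a) = T g (\<phi> a)"
proof -
  have hom: "continuous_on UNIV \<phi>"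
    using assoc by (simp add: associated_homeomorphism_def homeomorphism_def)
  have eq: "\<forall>y\<in>\<phi> ` U. T f y = T g y"
    using assms unfolding associated_homeomorphism_def by blast
  have "closed {x. T f (\<phi> x) = T g (\<phi> x)}"
    using cont hom by (intro closed_Collect_eq) (auto intro: continuous_on_compose2)
  moreover have "U \<subseteq> {x. T f (\<phi> x) = T g (\<phi> x)}"
    using eq by auto
  ultimately show ?thesis
    using closure_minimal \<open>a \<in> closure U\<close> by blast
qed

lemma associated_homeomorphism_pointwise:
  fixes T :: "('a::metric_space \<Rightarrow> 'c::real_normed_vector) \<Rightarrow> ('b::topological_space \<Rightarrow> 'd::t2_space)"
  assumes A: "A = contfun \<or> A = bcontfun" and cont: "\<And>f. f \<in> A \<Longrightarrow> continuous_on UNIV (T f)"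
    and assoc: "associated_homeomorphism A T \<phi>"
    and f: "f \<in> A" and g: "g \<in> A" and eq: "f a = g a"
  shows "T f (\<phi> a) = T g (\<phi> a)"
proof (cases "a islimpt UNIV")
  case False
  then have "open {a}"
    by (simp add: islimpt_UNIV_iff)
  then show ?thesis
    using associated_homeomorphism_eq_on_closure[OF assoc f g cont[OF f] cont[OF g], of "{a}" a] eq
    by simp
next
  case True
  obtain \<theta> :: "'a \<Rightarrow> real" and U V
    where U: "open U" "a \<in> closure U" "\<And>x. x \<in> U \<Longrightarrow> \<theta> x = 0"
      and V: "open V" "a \<in> closure V" "\<And>x. x \<in> V \<Longrightarrow> \<theta> x = 1"
      and \<theta>: "continuous_on (- {a}) \<theta>" "\<And>x. 0 \<le> \<theta> x" "\<And>x. \<theta> x \<le> 1"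
    using oscillating_cutoff[OF True] by metis
  define h where "h x = f x + \<theta> x *\<^sub>R (g x - f x)" for x
  have h: "h \<in> A"
    unfolding h_def using interpolation_in_function_space[OF A f g eq \<theta>] .
  have "T f (\<phi> a) = T h (\<phi> a)"
    by (rule associated_homeomorphism_eq_on_closure[OF assoc f h cont[OF f] cont[OF h] U(1) _ U(2)])
      (simp add: h_def U(3))
  also have "\<dots> = T g (\<phi> a)"
    by (rule associated_homeomorphism_eq_on_closure[OF assoc h g cont[OF h] cont[OF g] V(1) _ V(2)])
      (simp add: h_def V(3))
  finally show ?thesis .
qed

theorem proposition5p3:
  fixes A :: "('x::metric_space \<Rightarrow> 'e::real_normed_vector) set"
    and B :: "('y::metric_space \<Rightarrow> 'f::real_normed_vector) set"
    and T :: "('x \<Rightarrow> 'e) \<Rightarrow> ('y \<Rightarrow> 'f)"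
    and \<phi> :: "'x \<Rightarrow> 'y" and \<psi> :: "'y \<Rightarrow> 'x"
  assumes "\<exists>u::'e. u \<noteq> 0" and "\<exists>v::'f. v \<noteq> 0"
    and "A = contfun \<or> A = bcontfun"
    and "B = contfun \<or> B = bcontfun"
    and "biseparating A B T"
    and "associated_homeomorphism A T \<phi>"
    and "\<psi> = inv \<phi>"
  shows "\<exists>\<Phi> :: 'y \<times> 'e \<Rightarrow> 'f. \<forall>f\<in>A. \<forall>y. T f y = \<Phi> (y, f (\<psi> y))"
proof -
  have cont: "continuous_on UNIV (T f)" if "f \<in> A" for f
  proof -
    have "T f \<in> B"
      using assms(5) that by (auto simp: biseparating_def bij_betw_def)
    then show ?thesis
      using assms(4) by (auto simp: contfun_def bcontfun_def)
  qed
  have const: "(\<lambda>_. e) \<in> A" for e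
    using assms(3) by (auto simp: contfun_def bcontfun_def)
  have inv: "\<phi> (\<psi> y) = y" for y
    using assms(6,7) by (simp add: associated_homeomorphism_def homeomorphism_def)
  have "T f y = T (\<lambda>_. f (\<psi> y)) y" if "f \<in> A" for f y
    using associated_homeomorphism_pointwise[OF assms(3) cont assms(6) that const, of "\<psi> y" "f (\<psi> y)"]
    by (simp add: inv)
  then show ?thesis
    by (intro exI[of _ "\<lambda>(y, e). T (\<lambda>_. e) y"]) auto
qed

end
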